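(* Let $f$, $\mathcal{S}_x\subset\mathbb{R}^{n_x}$, $\mathcal{P}\subset\mathbb{R}^{n_p}$ and the flow $\nu_t$ of the initial value problem $\dot{x}(t)=f(x(t),p_0)$, $x(0)=x_0$, be as in the context. Let $\mathcal{N}_\theta:\mathbb{R}^{n_x}\times\mathbb{R}^{n_p}\to\mathbb{R}^{n_x}$ be an artificial neural network. Let $\eta_h$ be the discrete flow of an explicit one-step numerical scheme of order $p\in\mathbb{N}$ with step size $h>0$, and let $L_{\eta_h}$ be a Lipschitz constant of $\eta_h$. Let $L_{\mathcal{N}_\theta}$ be a Lipschitz constant of $\mathcal{N}_\theta$, and let $\epsilon>0$ be a scalar such that $$\bigl\lVert r(k,x_0,p_0)-h^{p+1}\,\mathcal{N}_\theta(\nu_{kh}(x_0,p_0),p_0)\bigr\rVert<\epsilon\,h^{p+1}\qquad\text{for all }k\in\mathbb{N},\ x_0\in\mathcal{S}_x,\ p_0\in\mathcal{P},$$ where $r$ is the local error $$r(k,x_0,p_0)=\nu_{(k+1)h}(x_0,p_0)-\eta_h\bigl(\nu_{kh}(x_0,p_0)\bigr).$$ Let $(\tilde{x}_k)_{k\ge 0}$ be defined by $\tilde{x}_0=x_0$ and $$\tilde{x}_{k+1}=\eta_h(\tilde{x}_k)+h^{p+1}\,\mathcal{N}_\theta(\tilde{x}_k,p_0),\qquad k\ge 0,$$ and consider the error $$e_{k+1}=\eta_h(\tilde{x}_k)+h^{p+1}\,\mathcal{N}_\theta(\tilde{x}_k,p_0)-\nu_{(k+1)h}(x_0,p_0).$$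 Set $\alpha=L_{\eta_h}+h^{p+1}L_{\mathcal{N}_\theta}$. Then for all $k\in\mathbb{N}$, $x_0\in\mathcal{S}_x$ and $p_0\in\mathcal{P}$, $$\lVert e_{k+1}\rVert\le\begin{cases}\dfrac{\exp\bigl((k+1)(\alpha-1)\bigr)-1}{\alpha-1}\,\epsilon\,h^{p+1},&\text{if }\alpha>1,\\[2mm](k+1)\,\epsilon\,h^{p+1},&\text{if }\alpha=1,\\[1mm]\dfrac{\epsilon\,h^{p+1}}{1-\alpha},&\text{if }0<\alpha<1.\end{cases}$$
   Context: Here $\mathbb{N}$ includes $0$ when used for the step index $k$. The integers $n_x,n_p\ge 1$ are dimensions, $\mathcal{S}_x\subset\mathbb{R}^{n_x}$ is a set of states and $\mathcal{P}\subset\mathbb{R}^{n_p}$ is a set of parameters. The vector field $f:\mathcal{S}_x\times\mathcal{P}\to\mathbb{R}^{n_x}$ is Lipschitz continuous in its first argument. The flow $\nu_t$ maps $(x_0,p_0)$ to $x(t)$, where $x$ is the solution of $\dot{x}(t)=f(x(t),p_0)$ with $x(0)=x_0$; it is taken to be defined at all times $t=kh$ that occur. $\lVert\cdot\rVert$ is a fixed norm on $\mathbb{R}^{n_x}$. An explicit one-step scheme with step size $h$ (e.g. an explicit Runge–Kutta method) approximates $x(kh)$ by the recursion $\tilde{x}_{k+1}=\eta_h(\tilde{x}_k)$, where the map $\eta_h:\mathbb{R}^{n_x}\to\mathbb{R}^{n_x}$ is called its discrete flow. It may depend on the parameter $p_0$, which is suppressed in the notation. The scheme is of order $p$ if its local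 error over one step is proportional to $h^{p+1}$. The integer $p$ (order) is unrelated to the parameter vector $p_0\in\mathcal{P}$. A Lipschitz constant $L_{\eta_h}$ of $\eta_h$ satisfies $\lVert\eta_h(x)-\eta_h(y)\rVert\le L_{\eta_h}\lVert x-y\rVert$ for all $x,y$ (for every value of $p_0\in\mathcal{P}$). A Lipschitz constant $L_{\mathcal{N}_\theta}$ of $\mathcal{N}_\theta$ satisfies in particular $\lVert\mathcal{N}_\theta(x,p_0)-\mathcal{N}_\theta(y,p_0)\rVert\le L_{\mathcal{N}_\theta}\lVert x-y\rVert$ for all $x,y,p_0$. An artificial neural network of depth $L$ is a map $T_L\circ\Xi\circ T_{L-1}\circ\Xi\circ\cdots\circ\Xi\circ T_1$, where each $T_l(x)=W^{(l)}x+b^{(l)}$ is affine-linear, $\Xi$ applies a Lipschitz continuous activation function $\xi:\mathbb{R}\to\mathbb{R}$ componentwise, and $\theta$ collects all $(W^{(l)},b^{(l)})$. *)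

theory Defs
  imports "HOL-Analysis.Analysis" "HOL-Library.Landau_Symbols" "HOL-Library.Countable_Set"
    "Jordan_Normal_Form.Matrix"
begin

(* HOL-Analysis and Jordan_Normal_Form both use the names vec and mat and the infix $.
   States and parameters live in real^'n and real^'m (HOL-Analysis).  The layers of a network have
   arbitrary widths, so weights and biases are Jordan_Normal_Form matrices and vectors, whose
   dimensions are natural numbers. *)

hide_type (open) Finite_Cartesian_Product.vec
hide_const (open) Finite_Cartesian_Product.vec
no_notation vec_index (infixl "$" 100)


definition is_norm :: "('a::real_vector \<Rightarrow> real) \<Rightarrow> bool" where
  "is_norm nrm \<longleftrightarrow>
     (\<forall>x. 0 \<le> nrm x) \<and>
     (\<forall>x. nrm x = 0 \<longleftrightarrow> x = 0) \<and>
     (\<forall>c x. nrm (c *\<^sub>R x) = \<bar>c\<bar> * nrm x) \<and>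
     (\<forall>x y. nrm (x + y) \<le> nrm x + nrm y)"

(* lipschitz_on refers to the Euclidean distance of the type; here the norm is a parameter. *)
definition is_lipschitz_constant ::
  "('a::real_vector \<Rightarrow> real) \<Rightarrow> real \<Rightarrow> ('a \<Rightarrow> 'a) \<Rightarrow> bool" where
  "is_lipschitz_constant nrm L g \<longleftrightarrow> (\<forall>x y. nrm (g x - g y) \<le> L * nrm (x - y))"


(* nu t x0 p0 is the value at time t of the solution of x' = f x p0, x 0 = x0.  The vector field
   has domain Sx \<times> P, so a solution takes its values in Sx.  All times k * h with k :: nat occur,
   so the solution lives on {0..}. *)
definition is_flow ::
  "('x::real_normed_vector) set \<Rightarrow> 'p set \<Rightarrow> ('x \<Rightarrow> 'p \<Rightarrow> 'x) \<Rightarrow> (real \<Rightarrow> 'x \<Rightarrow> 'p \<Rightarrow> 'x) \<Rightarrow> bool" where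
  "is_flow Sx P f \<nu> \<longleftrightarrow>
     (\<forall>x0\<in>Sx. \<forall>p0\<in>P.
        \<nu> 0 x0 p0 = x0 \<and>
        (\<forall>t\<ge>0. \<nu> t x0 p0 \<in> Sx \<and>
           ((\<lambda>s. \<nu> s x0 p0) has_vector_derivative f (\<nu> t x0 p0) p0) (at t within {0..})))"


(* An explicit one-step scheme is given by its discrete flows: \<eta> h p0 x is the result of one step
   of size h from x, for the parameter p0.  "Local error proportional to h^(p+1)" is a big-O
   statement for h \<rightarrow> 0+. *)
definition scheme_of_order ::
  "('x::real_vector \<Rightarrow> real) \<Rightarrow> 'x set \<Rightarrow> 'p set \<Rightarrow> (real \<Rightarrow> 'x \<Rightarrow> 'p \<Rightarrow> 'x) \<Rightarrow>
   (real \<Rightarrow> 'p \<Rightarrow> 'x \<Rightarrow> 'x) \<Rightarrow> nat \<Rightarrow> bool" where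
  "scheme_of_order nrm Sx P \<nu> \<eta> p \<longleftrightarrow>
     (\<forall>x0\<in>Sx. \<forall>p0\<in>P.
        (\<lambda>h. nrm (\<nu> h x0 p0 - \<eta> h p0 x0)) \<in> O[at_right 0](\<lambda>h. h ^ (p + 1)))"

definition local_error ::
  "(real \<Rightarrow> 'x \<Rightarrow> 'p \<Rightarrow> 'x) \<Rightarrow> (real \<Rightarrow> 'p \<Rightarrow> 'x \<Rightarrow> 'x::real_vector) \<Rightarrow> real \<Rightarrow>
   nat \<Rightarrow> 'x \<Rightarrow> 'p \<Rightarrow> 'x" where
  "local_error \<nu> \<eta> h k x0 p0 =
     \<nu> (real (k + 1) * h) x0 p0 - \<eta> h p0 (\<nu> (real k * h) x0 p0)"


(* The list of all (W, b), first layer first. *)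
type_synonym ann_params = "(real mat \<times> real vec) list"

(* The depth (number of layers) is at least 1; m and n are the input and output dimension. *)
primrec valid_ann :: "nat \<Rightarrow> nat \<Rightarrow> ann_params \<Rightarrow> bool" where
  "valid_ann m n [] \<longleftrightarrow> False"
| "valid_ann m n (T # Ts) \<longleftrightarrow>
     (case T of (W, b) \<Rightarrow>
        W \<in> carrier_mat (dim_row W) m \<and> b \<in> carrier_vec (dim_row W) \<and>
        (if Ts = [] then dim_row W = n else valid_ann (dim_row W) n Ts))"

(* The activation is applied between consecutive layers, not after the last one. *)
primrec ann_eval :: "(real \<Rightarrow> real) \<Rightarrow> ann_params \<Rightarrow> real vec \<Rightarrow> real vec" where
  "ann_eval \<xi> [] v = v"
| "ann_eval \<xi> (T # Ts) v =
     (case T of (W, b) \<Rightarrow>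
        if Ts = [] then W *\<^sub>v v + b
        else ann_eval \<xi> Ts (map_vec \<xi> (W *\<^sub>v v + b)))"

(* Passage between real^'n and vectors indexed by {..<CARD('n)}; to_nat_on UNIV is a bijection of
   the finite type 'n onto {..<CARD('n)} with inverse from_nat_into UNIV. *)
definition to_vec :: "real ^ 'n \<Rightarrow> real vec" where
  "to_vec x = Matrix.vec CARD('n) (\<lambda>i. x $ from_nat_into (UNIV :: 'n set) i)"

definition of_vec :: "real vec \<Rightarrow> real ^ 'n" where
  "of_vec v = (\<chi> i. vec_index v (to_nat_on (UNIV :: 'n set) i))"

definition ann :: "(real \<Rightarrow> real) \<Rightarrow> ann_params \<Rightarrow> (real ^ 'n) \<times> (real ^ 'm) \<Rightarrow> real ^ 'n" where
  "ann \<xi> \<theta> = (\<lambda>(x, q). of_vec (ann_eval \<xi> \<theta> (to_vec x @\<^sub>v to_vec q)))"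

end

theory Submission imports Defs begin

text \<open>One corrected step \<open>\<Phi> x = \<eta> h p0 x + h ^ (p + 1) *\<^sub>R N (x, p0)\<close> has Lipschitz constant \<open>\<alpha>\<close>, and
  the hypothesis on \<open>\<epsilon>\<close> says exactly that the sampled flow fails to be an orbit of \<open>\<Phi>\<close> by at most
  \<open>c = \<epsilon> * h ^ (p + 1)\<close> per step. So the error obeys \<open>d (Suc k) \<le> \<alpha> * d k + c\<close> with \<open>d 0 = 0\<close>, which
  gives \<open>d n \<le> c * (\<Sum>i<n. \<alpha> ^ i)\<close>; for \<open>\<alpha> > 1\<close> the exponential enters through
  \<open>\<alpha> \<le> exp (\<alpha> - 1)\<close>.\<close>

text \<open>Unrolling the recurrence contributes one more power of \<open>\<alpha>\<close> per step.
  The sum is kept unevaluated, so that one induction serves all three ranges of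
  \<open>\<alpha>\<close>.\<close>

lemma affine_recurrence_le_geometric_sum:
  fixes d :: "nat \<Rightarrow> real"
  assumes "\<alpha> \<ge> 0" and "d 0 \<le> 0" and "\<And>k. d (Suc k) \<le> \<alpha> * d k + c"
  shows "d n \<le> c * (\<Sum>i<n. \<alpha> ^ i)"
proof (induction n)
  case 0
  show ?case using assms(2) by simp
next
  case (Suc n)
  have "d (Suc n) \<le> \<alpha> * (c * (\<Sum>i<n. \<alpha> ^ i)) + c"
    using assms(3)[of n] mult_left_mono[OF Suc.IH assms(1)] by linarith
  \<comment> \<open>Multiplying the sum by \<open>\<alpha>\<close> shifts every exponent up by one,
    and the added \<open>c\<close> supplies the missing term for exponent 0; hence the sum is split
    at its first term, not its last.\<close>
  also have "\<dots> = c * (\<Sum>i<Suc n. \<alpha> ^ i)"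
    by (simp only: sum.lessThan_Suc_shift) (simp add: sum_distrib_left algebra_simps)
  finally show ?case .
qed

lemma geometric_sum_le_exp:
  fixes \<alpha> :: real
  assumes "\<alpha> > 1"
  shows "(\<Sum>i<n. \<alpha> ^ i) \<le> (exp (real n * (\<alpha> - 1)) - 1) / (\<alpha> - 1)"
proof -
  have "\<alpha> ^ n \<le> exp (\<alpha> - 1) ^ n"
    using assms exp_ge_add_one_self[of "\<alpha> - 1"] by (intro power_mono) auto
  also have "\<dots> = exp (real n * (\<alpha> - 1))"
    by (simp add: exp_of_nat_mult)
  finally have "(\<alpha> ^ n - 1) / (\<alpha> - 1) \<le> (exp (real n * (\<alpha> - 1)) - 1) / (\<alpha> - 1)"
    using assms by (simp add: divide_right_mono)
  then show ?thesis
    using assms by (simp add: geometric_sum)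
qed

text \<open>The bound is the value of the full infinite series, hence uniform in \<open>n\<close>:
  for a contractive step the accumulated error stays bounded for all time.\<close>

lemma geometric_sum_le_inverse:
  fixes \<alpha> :: real
  assumes "0 \<le> \<alpha>" and "\<alpha> < 1"
  shows "(\<Sum>i<n. \<alpha> ^ i) \<le> 1 / (1 - \<alpha>)"
proof -
  have "(\<Sum>i<n. \<alpha> ^ i) = (1 - \<alpha> ^ n) / (1 - \<alpha>)"
    using assms by (simp add: sum_gp_strict)
  also have "\<dots> \<le> 1 / (1 - \<alpha>)"
    using assms by (intro divide_right_mono) auto
  finally show ?thesis .
qed

lemma is_norm_zero: "is_norm nrm \<Longrightarrow> nrm 0 = 0"
  and is_norm_scaleR: "is_norm nrm \<Longrightarrow> nrm (c *\<^sub>R x) = \<bar>c\<bar> * nrm x"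
  and is_norm_triangle: "is_norm nrm \<Longrightarrow> nrm (x + y) \<le> nrm x + nrm y"
  by (simp_all add: is_norm_def)

lemma is_norm_diff_triangle:
  assumes "is_norm nrm"
  shows "nrm (x - y) \<le> nrm x + nrm y"
  using is_norm_triangle[OF assms, of x "- 1 *\<^sub>R y"] is_norm_scaleR[OF assms, of "- 1" y]
  by simp

lemma is_lipschitz_constant_add_scaleR:
  assumes "is_norm nrm" and "is_lipschitz_constant nrm L g" and "is_lipschitz_constant nrm M k"
    and "c \<ge> 0"
  shows "is_lipschitz_constant nrm (L + c * M) (\<lambda>x. g x + c *\<^sub>R k x)"
  unfolding is_lipschitz_constant_def
proof (intro allI)
  fix x y
  have "nrm (g x + c *\<^sub>R k x - (g y + c *\<^sub>R k y)) = nrm ((g x - g y) + c *\<^sub>R (k x - k y))"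
    by (simp add: algebra_simps)
  also have "\<dots> \<le> nrm (g x - g y) + c * nrm (k x - k y)"
    using is_norm_triangle[OF assms(1), of "g x - g y" "c *\<^sub>R (k x - k y)"] \<open>c \<ge> 0\<close>
    by (simp add: is_norm_scaleR[OF assms(1)])
  also have "\<dots> \<le> L * nrm (x - y) + c * (M * nrm (x - y))"
    using assms(2-4) by (intro add_mono mult_left_mono) (auto simp: is_lipschitz_constant_def)
  finally show "nrm (g x + c *\<^sub>R k x - (g y + c *\<^sub>R k y)) \<le> (L + c * M) * nrm (x - y)"
    by (simp add: algebra_simps)
qed

text \<open>The defect is measured along \<open>v\<close>, which later is the exact trajectory. Old
  error is propagated by the Lipschitz bound on \<open>\<Phi>\<close>, and new error enters only
  through the defect.\<close>

lemma perturbed_orbit_distance: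
  assumes "is_norm nrm" and "is_lipschitz_constant nrm \<alpha> \<Phi>" and "\<alpha> \<ge> 0"
    and "u 0 = v 0" and "\<And>k. u (Suc k) = \<Phi> (u k)"
    and defect: "\<And>k. nrm (v (Suc k) - \<Phi> (v k)) \<le> c"
  shows "nrm (u n - v n) \<le> c * (\<Sum>i<n. \<alpha> ^ i)"
proof (rule affine_recurrence_le_geometric_sum[where d = "\<lambda>k. nrm (u k - v k)"])
  show "nrm (u 0 - v 0) \<le> 0"
    using assms(1,4) by (simp add: is_norm_zero)
  fix k
  \<comment> \<open>The intermediate point is \<open>\<Phi> (v k)\<close>, one approximate step
    started from the exact value.\<close>
  have "nrm (u (Suc k) - v (Suc k)) = nrm ((\<Phi> (u k) - \<Phi> (v k)) - (v (Suc k) - \<Phi> (v k)))"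
    by (simp add: assms(5))
  also have "\<dots> \<le> nrm (\<Phi> (u k) - \<Phi> (v k)) + nrm (v (Suc k) - \<Phi> (v k))"
    by (rule is_norm_diff_triangle[OF assms(1)])
  also have "\<dots> \<le> \<alpha> * nrm (u k - v k) + c"
    using assms(2) defect[of k] unfolding is_lipschitz_constant_def by (intro add_mono) auto
  finally show "nrm (u (Suc k) - v (Suc k)) \<le> \<alpha> * nrm (u k - v k) + c" .
qed (use assms in auto)

theorem proposition1:
  fixes Sx :: "(real ^ 'n) set" and P :: "(real ^ 'm) set"
    and f :: "real ^ 'n \<Rightarrow> real ^ 'm \<Rightarrow> real ^ 'n"
    and \<nu> :: "real \<Rightarrow> real ^ 'n \<Rightarrow> real ^ 'm \<Rightarrow> real ^ 'n"
    and nrm :: "real ^ 'n \<Rightarrow> real"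
    and \<eta> :: "real \<Rightarrow> real ^ 'm \<Rightarrow> real ^ 'n \<Rightarrow> real ^ 'n"
    and p :: nat and h \<epsilon> L\<eta> LN \<alpha> :: real
    and \<xi> :: "real \<Rightarrow> real" and \<theta> :: ann_params
    and N :: "(real ^ 'n) \<times> (real ^ 'm) \<Rightarrow> real ^ 'n"
    and xt e :: "real ^ 'n \<Rightarrow> real ^ 'm \<Rightarrow> nat \<Rightarrow> real ^ 'n"
  assumes "is_norm nrm"
    and "\<And>p0. p0 \<in> P \<Longrightarrow> \<exists>C. C-lipschitz_on Sx (\<lambda>x. f x p0)"
    and "is_flow Sx P f \<nu>"
    and "\<exists>C. C-lipschitz_on UNIV \<xi>"
    and "valid_ann (CARD('n) + CARD('m)) CARD('n) \<theta>"
    and "N = ann \<xi> \<theta>"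
    and "h > 0"
    and "scheme_of_order nrm Sx P \<nu> \<eta> p"
    and "\<And>p0. p0 \<in> P \<Longrightarrow> is_lipschitz_constant nrm L\<eta> (\<eta> h p0)"
    and "\<And>p0. is_lipschitz_constant nrm LN (\<lambda>x. N (x, p0))"
    and "\<epsilon> > 0"
    and "\<And>k x0 p0. x0 \<in> Sx \<Longrightarrow> p0 \<in> P \<Longrightarrow>
           nrm (local_error \<nu> \<eta> h k x0 p0 - h ^ (p + 1) *\<^sub>R N (\<nu> (real k * h) x0 p0, p0))
             < \<epsilon> * h ^ (p + 1)"
    and "\<And>x0 p0. xt x0 p0 0 = x0"
    and "\<And>x0 p0 k. xt x0 p0 (Suc k) =
           \<eta> h p0 (xt x0 p0 k) + h ^ (p + 1) *\<^sub>R N (xt x0 p0 k, p0)"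
    and "\<And>x0 p0 k. e x0 p0 (Suc k) =
           \<eta> h p0 (xt x0 p0 k) + h ^ (p + 1) *\<^sub>R N (xt x0 p0 k, p0) - \<nu> (real (k + 1) * h) x0 p0"
    and "\<alpha> = L\<eta> + h ^ (p + 1) * LN"
  shows "\<forall>k. \<forall>x0\<in>Sx. \<forall>p0\<in>P.
     (\<alpha> > 1 \<longrightarrow>
        nrm (e x0 p0 (k + 1)) \<le> (exp (real (k + 1) * (\<alpha> - 1)) - 1) / (\<alpha> - 1) * \<epsilon> * h ^ (p + 1)) \<and>
     (\<alpha> = 1 \<longrightarrow> nrm (e x0 p0 (k + 1)) \<le> real (k + 1) * \<epsilon> * h ^ (p + 1)) \<and>
     (0 < \<alpha> \<and> \<alpha> < 1 \<longrightarrow> nrm (e x0 p0 (k + 1)) \<le> \<epsilon> * h ^ (p + 1) / (1 - \<alpha>))"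
proof (intro allI ballI)
  fix k x0 p0
  assume x0: "x0 \<in> Sx" and p0: "p0 \<in> P"
  define \<Phi> where "\<Phi> = (\<lambda>x. \<eta> h p0 x + h ^ (p + 1) *\<^sub>R N (x, p0))"
  define c where "c = \<epsilon> * h ^ (p + 1)"
  have c: "c \<ge> 0"
    using assms(7,11) by (simp add: c_def)
  have lip: "is_lipschitz_constant nrm \<alpha> \<Phi>"
    unfolding \<Phi>_def assms(16) using assms(7)
    by (intro is_lipschitz_constant_add_scaleR assms(1,9,10) p0) simp
  have start: "xt x0 p0 0 = \<nu> (real 0 * h) x0 p0"
    using assms(3,13) x0 p0 by (simp add: is_flow_def)
  have step: "xt x0 p0 (Suc j) = \<Phi> (xt x0 p0 j)" for j
    by (simp add: assms(14) \<Phi>_def)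
  \<comment> \<open>Subtracting the network term from the local error subtracts both summands of
    \<open>\<Phi>\<close> from the next flow value, so this is the hypothesis on \<epsilon>, with
    the strict inequality weakened.\<close>
  have defect: "nrm (\<nu> (real (Suc j) * h) x0 p0 - \<Phi> (\<nu> (real j * h) x0 p0)) \<le> c" for j
    using assms(12)[OF x0 p0, of j] unfolding local_error_def \<Phi>_def c_def
    by (simp add: diff_diff_eq)
  \<comment> \<open>The assumption on \<open>e\<close> fixes its values only at successor indices,
    so the identification with the distance between the orbits is made at
    \<open>k + 1\<close>.\<close>
  have e: "e x0 p0 (k + 1) = xt x0 p0 (k + 1) - \<nu> (real (k + 1) * h) x0 p0"
    by (simp add: assms(14,15))
  \<comment> \<open>Nonnegativity of \<open>\<alpha>\<close> stays a premise here; each of the three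
    cases below supplies it.\<close>
  have bound: "nrm (e x0 p0 (k + 1)) \<le> c * (\<Sum>i<k + 1. \<alpha> ^ i)" if "\<alpha> \<ge> 0"
    unfolding e
    by (rule perturbed_orbit_distance[OF assms(1) lip that,
          where u = "xt x0 p0" and v = "\<lambda>j. \<nu> (real j * h) x0 p0", OF start step defect])
  have transfer: "nrm (e x0 p0 (k + 1)) \<le> s * c"
    if "\<alpha> \<ge> 0" and "(\<Sum>i<k + 1. \<alpha> ^ i) \<le> s" for s
    using bound[OF that(1)] mult_left_mono[OF that(2) c] by (simp add: mult.commute)
  show "(\<alpha> > 1 \<longrightarrow>
        nrm (e x0 p0 (k + 1)) \<le> (exp (real (k + 1) * (\<alpha> - 1)) - 1) / (\<alpha> - 1) * \<epsilon> * h ^ (p + 1)) \<and>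
     (\<alpha> = 1 \<longrightarrow> nrm (e x0 p0 (k + 1)) \<le> real (k + 1) * \<epsilon> * h ^ (p + 1)) \<and>
     (0 < \<alpha> \<and> \<alpha> < 1 \<longrightarrow> nrm (e x0 p0 (k + 1)) \<le> \<epsilon> * h ^ (p + 1) / (1 - \<alpha>))"
  proof (intro conjI impI)
    assume "\<alpha> > 1"
    then show "nrm (e x0 p0 (k + 1)) \<le>
        (exp (real (k + 1) * (\<alpha> - 1)) - 1) / (\<alpha> - 1) * \<epsilon> * h ^ (p + 1)"
      using transfer[OF _ geometric_sum_le_exp] by (simp only: c_def mult.assoc)
  next
    assume "\<alpha> = 1"
    then show "nrm (e x0 p0 (k + 1)) \<le> real (k + 1) * \<epsilon> * h ^ (p + 1)"
      \<comment> \<open>For \<open>\<alpha> = 1\<close> all \<open>k + 1\<close> summands equal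
        1.\<close>
      using transfer[of "real (k + 1)"] by (simp add: c_def mult.assoc)
  next
    assume "0 < \<alpha> \<and> \<alpha> < 1"
    then show "nrm (e x0 p0 (k + 1)) \<le> \<epsilon> * h ^ (p + 1) / (1 - \<alpha>)"
      using transfer[OF _ geometric_sum_le_inverse] by (simp add: c_def)
  qed
qed

end
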